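(* If $d:[0,1]\to\mathbb{C}$ is any path (continuous function) whose image is not contained in a straight line, then $Q_\lambda(d)=R_\lambda(d)=\mathbb{C}$ for all $\lambda\in\mathbb{C}\setminus[0,1]$, where $Q_\lambda(d)$ and $R_\lambda(d)$ mean $Q_\lambda(S)$ and $R_\lambda(S)$ for $S=d([0,1])$.
   Context: For $\lambda\in\mathbb{C}$, a set $A\subseteq\mathbb{C}$ is $\lambda$-convex if for all $a,b\in A$ the point $(1-\lambda)a+\lambda b$ is in $A$; it is $\lambda$-clonvex if it is $\lambda$-convex and topologically closed in $\mathbb{C}$. For $S\subseteq\mathbb{C}$, $Q_\lambda(S)$ is the smallest $\lambda$-convex set containing $S$, and $R_\lambda(S)$ is the smallest $\lambda$-clonvex set containing $S$. The set $[0,1]$ in $\mathbb{C}\setminus[0,1]$ is the closed real unit interval. *)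

theory Defs
  imports "HOL-Analysis.Analysis"
begin

text \<open>
  Throughout, the complex parameter \<open>l\<close> is the \<open>\<lambda>\<close> of the terms \<open>\<lambda>\<close>-convex and
  \<open>\<lambda>\<close>-clonvex.
\<close>

definition lam_convex :: "complex \<Rightarrow> complex set \<Rightarrow> bool" where
  "lam_convex l A \<longleftrightarrow> (\<forall>a\<in>A. \<forall>b\<in>A. (1 - l) * a + l * b \<in> A)"

definition lam_clonvex :: "complex \<Rightarrow> complex set \<Rightarrow> bool" where
  "lam_clonvex l A \<longleftrightarrow> lam_convex l A \<and> closed A"

definition Q_hull :: "complex \<Rightarrow> complex set \<Rightarrow> complex set" where
  "Q_hull l S = lam_convex l hull S"

definition R_hull :: "complex \<Rightarrow> complex set \<Rightarrow> complex set" where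
  "R_hull l S = lam_clonvex l hull S"

text \<open>
  The operator \<open>hull\<close> is an intersection over all supersets with the property; the next two
  lemmas justify reading it as the smallest such superset.
\<close>

lemma Q_hull_smallest:
  "lam_convex l (Q_hull l S) \<and> S \<subseteq> Q_hull l S \<and>
   (\<forall>T. lam_convex l T \<and> S \<subseteq> T \<longrightarrow> Q_hull l S \<subseteq> T)"
  unfolding Q_hull_def hull_def lam_convex_def by blast

lemma R_hull_smallest:
  "lam_clonvex l (R_hull l S) \<and> S \<subseteq> R_hull l S \<and>
   (\<forall>T. lam_clonvex l T \<and> S \<subseteq> T \<longrightarrow> R_hull l S \<subseteq> T)"
proof -
  have "closed (R_hull l S)"
    unfolding R_hull_def hull_def lam_clonvex_def by (rule closed_Inter) blast
  moreover have "lam_convex l (R_hull l S)"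
    unfolding R_hull_def hull_def lam_clonvex_def lam_convex_def by blast
  moreover have "S \<subseteq> R_hull l S" "\<forall>T. lam_clonvex l T \<and> S \<subseteq> T \<longrightarrow> R_hull l S \<subseteq> T"
    unfolding R_hull_def hull_def by blast+
  ultimately show ?thesis
    unfolding lam_clonvex_def by blast
qed

end

theory Submission
  imports Defs
begin

text \<open>
  Choose two subpaths \<open>\<alpha>\<close>, \<open>\<beta>\<close> of \<open>d\<close> such that the displacements of \<open>(1 - \<lambda>) \<alpha>\<close> and
  \<open>\<lambda> \<beta>\<close> are linearly independent vectors \<open>u\<close>, \<open>w\<close>.  Extend both paths quasi-periodically
  to the whole line, with \<open>u\<close>, \<open>w\<close> as the translations over one period.  The sum of the two extensions,
  regarded as a map of the plane in the coordinates given by \<open>u\<close>, \<open>w\<close>, stays within bounded distance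
  of the identity and is therefore onto by Brouwer's theorem.  Hence countably many translates of the
  compact set \<open>(1 - \<lambda>) \<alpha> + \<lambda> \<beta>\<close> cover the plane, and by Baire's theorem this set has
  interior points.  Finally, a \<open>\<lambda>\<close>-convex set containing a disc of radius \<open>r\<close> contains the
  concentric disc of radius \<open>(\<bar>1 - \<lambda>\<bar> + \<bar>\<lambda>\<bar>) r\<close>, and \<open>\<bar>1 - \<lambda>\<bar> + \<bar>\<lambda>\<bar> > 1\<close>.
\<close>

text \<open>A preimage of \<open>y\<close> is a fixed point of the map sending \<open>x\<close> to
  \<open>y + (x - f x)\<close>, and this map takes its values in \<open>cball y M\<close>.\<close>

lemma surj_if_bounded_dist_id:
  fixes f :: "'a::euclidean_space \<Rightarrow> 'a"
  assumes cont: "continuous_on UNIV f" and bd: "\<And>x. norm (f x - x) \<le> M"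
  shows "surj f"
  unfolding surj_def
proof
  fix y
  have "M \<ge> 0" using order_trans[OF norm_ge_zero bd[of 0]] .
  have "continuous_on (cball y M) (\<lambda>x. y + (x - f x))"
    by (intro continuous_intros continuous_on_subset[OF cont]) auto
  moreover have "(\<lambda>x. y + (x - f x)) \<in> cball y M \<rightarrow> cball y M"
    using bd by (auto simp: dist_norm norm_minus_commute)
  ultimately obtain x where "y + (x - f x) = x"
    using brouwer[of "cball y M" "\<lambda>x. y + (x - f x)"] \<open>M \<ge> 0\<close> by auto
  then show "\<exists>x. y = f x" by (intro exI[of _ x]) (simp add: algebra_simps)
qed

text \<open>\<open>frac\<close> jumps at the integers, but \<open>p\<close> takes equal values at
  both ends of the unit interval, so it factors through the unit circle.\<close>

lemma continuous_on_loop_frac: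
  fixes p :: "real \<Rightarrow> 'a::real_normed_vector"
  assumes "path p" and "pathfinish p = pathstart p"
  shows "continuous_on UNIV (\<lambda>x. p (frac x))"
proof -
  \<comment> \<open>The trivial homotopy from \<open>p\<close> to itself serves to obtain continuity
    of the map that \<open>p\<close> induces on the circle.\<close>
  have "homotopic_loops (path_image p) p p"
    using assms by (simp add: homotopic_loops_refl)
  from homotopic_loops_imp_homotopic_circlemaps[OF this]
  have circ: "continuous_on (sphere 0 1) (p \<circ> (\<lambda>z. Arg2pi z / (2 * pi)))"
    by (rule homotopic_with_imp_continuous[THEN conjunct1])
  have "continuous_on UNIV (\<lambda>x. (p \<circ> (\<lambda>z. Arg2pi z / (2 * pi))) (cis (2 * pi * x)))"
    by (rule continuous_on_compose2[OF circ]) (auto intro!: continuous_intros)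
  moreover have "Arg2pi (cis (2 * pi * x)) / (2 * pi) = frac x" for x
  proof -
    have "cis (2 * pi * x) = cis (2 * pi * frac x) * cis (2 * pi * of_int \<lfloor>x\<rfloor>)"
      by (simp add: cis_mult frac_def algebra_simps)
    also have "cis (2 * pi * of_int \<lfloor>x\<rfloor>) = 1"
      by (rule cis_multiple_2pi) simp
    finally have "Arg2pi (cis (2 * pi * x)) = 2 * pi * frac x"
      by (intro Arg2pi_unique[of 1])
        (auto simp: cis_conv_exp frac_lt_1 simp del: of_real_mult)
    then show ?thesis by simp
  qed
  ultimately show ?thesis by simp
qed

text \<open>Subtracting the linear drift \<open>x * u\<close> turns \<open>g\<close> into a loop.
  Its periodic extension is continuous and bounded; adding the drift back gives \<open>G\<close>,
  which on each unit interval starting at an integer \<open>n\<close> is \<open>g\<close> translated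
  by \<open>n * u\<close>.\<close>

lemma path_quasiperiodic_extension:
  fixes g :: "real \<Rightarrow> complex"
  assumes "path g"
  defines "u \<equiv> pathfinish g - pathstart g"
  obtains G M where "continuous_on UNIV G"
    and "\<And>x. \<exists>n::int. G x - of_int n * u \<in> path_image g"
    and "\<And>x. norm (G x - of_real x * u) \<le> M"
proof -
  define p where "p = (\<lambda>x. g x - of_real x * u)"
  have p: "path p"
    using assms(1) unfolding p_def path_def by (intro continuous_intros)
  moreover have "pathfinish p = pathstart p"
    by (simp add: p_def u_def pathfinish_def pathstart_def)
  ultimately have cont: "continuous_on UNIV (\<lambda>x. p (frac x))"
    by (rule continuous_on_loop_frac)
  obtain M where M: "\<And>z. z \<in> path_image p \<Longrightarrow> norm z \<le> M"
    using bounded_path_image[OF p] by (auto simp: bounded_iff)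
  have frac01: "frac x \<in> {0..1}" for x :: real
    by (simp add: frac_lt_1 less_imp_le)
  show thesis
  proof
    show "continuous_on UNIV (\<lambda>x. p (frac x) + of_real x * u)"
      by (intro continuous_intros cont)
    show "\<exists>n::int. p (frac x) + of_real x * u - of_int n * u \<in> path_image g" for x
    proof
      have "p (frac x) + of_real x * u - of_int \<lfloor>x\<rfloor> * u = g (frac x)"
        by (simp add: p_def frac_def algebra_simps)
      then show "p (frac x) + of_real x * u - of_int \<lfloor>x\<rfloor> * u \<in> path_image g"
        using frac01 by (simp add: path_image_def)
    qed
    show "norm (p (frac x) + of_real x * u - of_real x * u) \<le> M" for x
      using M frac01 by (simp add: path_image_def)
  qed
qed

text \<open>Cramer's rule: \<open>Im (cnj u * w)\<close> is the determinant of \<open>u\<close> and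
  \<open>w\<close> as vectors of the real plane.\<close>

lemma complex_coordinates:
  assumes "Im (cnj u * w) \<noteq> 0"
  shows "z = of_real (Im (cnj w * z) / Im (cnj w * u)) * u
           + of_real (Im (cnj u * z) / Im (cnj u * w)) * w"
proof -
  define D where "D = Re u * Im w - Im u * Re w"
  have D: "D \<noteq> 0" "Im (cnj u * w) = D" "Im (cnj w * u) = - D"
    using assms by (auto simp: D_def algebra_simps)
  have "of_real D * z = - of_real (Im (cnj w * z)) * u + of_real (Im (cnj u * z)) * w"
    by (rule complex_eqI) (simp_all add: D_def algebra_simps)
  moreover have "x = of_real (p / - D) * u + of_real (q / D) * w"
    if "of_real D * x = - of_real p * u + of_real q * w" for p q x
  proof -
    have "x = (- of_real p * u + of_real q * w) / of_real D"
      unfolding that[symmetric] using D(1) by simp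
    then show ?thesis by (simp add: diff_divide_distrib)
  qed
  ultimately show ?thesis unfolding D(2,3) by blast
qed

lemma interior_nonempty_if_translates_cover:
  fixes K :: "'a::euclidean_space set"
  assumes "closed K" and "countable T" and cover: "\<And>z. \<exists>t\<in>T. z - t \<in> K"
  shows "interior K \<noteq> {}"
proof
  assume empty: "interior K = {}"
  \<comment> \<open>Complements of the translates of \<open>K\<close> are open, and dense because
    \<open>K\<close> has empty interior. Baire makes their intersection dense, whereas the covering
    makes it empty.\<close>
  define \<G> where "\<G> = (\<lambda>t. - ((+) t ` K)) ` T"
  have "(UNIV :: 'a set) \<subseteq> closure (\<Inter>\<G>)"
  proof (rule Baire)
    show "countable \<G>" unfolding \<G>_def using assms(2) by simp
    fix S assume "S \<in> \<G>"
    then obtain t where S: "S = - ((+) t ` K)" unfolding \<G>_def by blast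
    show "openin (top_of_set UNIV) S \<and> UNIV \<subseteq> closure S"
      unfolding S using assms(1) empty
      by (auto simp: closed_translation closure_complement interior_translation)
  qed simp
  moreover have "\<Inter>\<G> = {}"
  proof (rule ccontr)
    assume "\<Inter>\<G> \<noteq> {}"
    then obtain z where z: "z \<in> \<Inter>\<G>" by blast
    obtain t where t: "t \<in> T" "z - t \<in> K" using cover by blast
    then have "z \<in> (+) t ` K" by (intro image_eqI[of _ _ "z - t"]) auto
    with z t show False unfolding \<G>_def by blast
  qed
  ultimately show False by simp
qed

lemma interior_sum_path_images:
  fixes g h :: "real \<Rightarrow> complex"
  assumes "path g" "path h"
    and indep: "Im (cnj (pathfinish g - pathstart g) * (pathfinish h - pathstart h)) \<noteq> 0"
  shows "interior {x + y |x y. x \<in> path_image g \<and> y \<in> path_image h} \<noteq> {}"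
proof -
  define u where "u = pathfinish g - pathstart g"
  define w where "w = pathfinish h - pathstart h"
  have uw: "Im (cnj u * w) \<noteq> 0" using indep by (simp add: u_def w_def)
  obtain G M where G: "continuous_on UNIV G"
    "\<And>x. \<exists>n::int. G x - of_int n * u \<in> path_image g"
    "\<And>x. norm (G x - of_real x * u) \<le> M"
    by (rule path_quasiperiodic_extension[OF assms(1), folded u_def]) (rule that)
  obtain H N where H: "continuous_on UNIV H"
    "\<And>x. \<exists>n::int. H x - of_int n * w \<in> path_image h"
    "\<And>x. norm (H x - of_real x * w) \<le> N"
    by (rule path_quasiperiodic_extension[OF assms(2), folded w_def]) (rule that)
  \<comment> \<open>\<open>s\<close> and \<open>t\<close> are the real coordinates in the basis
    \<open>u\<close>, \<open>w\<close>; feeding them to \<open>G\<close> and \<open>H\<close> makes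
    the sum approximate \<open>z\<close> itself.\<close>
  define s where "s = (\<lambda>z. Im (cnj w * z) / Im (cnj w * u))"
  define t where "t = (\<lambda>z. Im (cnj u * z) / Im (cnj u * w))"
  have wu: "Im (cnj w * u) \<noteq> 0" using uw by (simp add: algebra_simps)
  have "continuous_on UNIV s" "continuous_on UNIV t"
    unfolding s_def t_def using uw wu by (auto intro!: continuous_intros)
  then have "continuous_on UNIV (\<lambda>z. G (s z) + H (t z))"
    by (intro continuous_on_add continuous_on_compose2[OF G(1)] continuous_on_compose2[OF H(1)]) auto
  moreover have "norm (G (s z) + H (t z) - z) \<le> M + N" for z
  proof -
    have "z = of_real (s z) * u + of_real (t z) * w"
      unfolding s_def t_def by (rule complex_coordinates[OF uw])
    then have "G (s z) + H (t z) - z = (G (s z) - of_real (s z) * u) + (H (t z) - of_real (t z) * w)"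
      by (simp add: algebra_simps)
    then show ?thesis
      using norm_triangle_mono[OF G(3) H(3)] by metis
  qed
  ultimately have surj: "surj (\<lambda>z. G (s z) + H (t z))"
    by (rule surj_if_bounded_dist_id)
  \<comment> \<open>\<open>G\<close> and \<open>H\<close> leave the path images only by integer
    multiples of \<open>u\<close> and \<open>w\<close>, so this countable lattice supplies all
    translations needed.\<close>
  let ?L = "range (\<lambda>(m::int, n::int). of_int m * u + of_int n * w)"
  show ?thesis
  proof (rule interior_nonempty_if_translates_cover)
    show "closed {x + y |x y. x \<in> path_image g \<and> y \<in> path_image h}"
      using assms by (intro compact_imp_closed compact_sums compact_path_image)
    show "countable ?L" by simp
    fix z
    obtain v where v: "z = G (s v) + H (t v)" using surj by (rule surjE)
    obtain m n :: int where mn: "G (s v) - of_int m * u \<in> path_image g"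
      "H (t v) - of_int n * w \<in> path_image h" using G(2) H(2) by metis
    have "z - (of_int m * u + of_int n * w) = (G (s v) - of_int m * u) + (H (t v) - of_int n * w)"
      using v by simp
    then have "z - (of_int m * u + of_int n * w) \<in> {x + y |x y. x \<in> path_image g \<and> y \<in> path_image h}"
      using mn by blast
    then show "\<exists>l\<in>?L. z - l \<in> {x + y |x y. x \<in> path_image g \<and> y \<in> path_image h}"
      by (intro bexI[of _ "of_int m * u + of_int n * w"]) auto
  qed
qed

text \<open>Equality in the triangle inequality for 0, \<open>l\<close>, 1 would put
  \<open>l\<close> on the segment from 0 to 1.\<close>

lemma norm_one_minus_add_norm_gt_1:
  assumes "l \<notin> complex_of_real ` {0..1}"
  shows "norm (1 - l) + norm l > 1"
proof (rule ccontr)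
  assume "\<not> norm (1 - l) + norm l > 1"
  moreover have "norm (1 - l) + norm l \<ge> 1"
    using norm_triangle_ineq[of "1 - l" l] by simp
  ultimately have "between (0, 1) l"
    by (simp add: between dist_norm norm_minus_commute)
  then obtain t where "0 \<le> t" "t \<le> 1" "l = complex_of_real t"
    by (auto simp: between_mem_segment in_segment scaleR_conv_of_real)
  with assms show False by auto
qed

lemma lam_convex_ball_expand:
  assumes A: "lam_convex l A" and "ball c r \<subseteq> A" and pos: "norm (1 - l) + norm l > 0"
  shows "ball c ((norm (1 - l) + norm l) * r) \<subseteq> A"
proof
  define \<rho> where "\<rho> = norm (1 - l) + norm l"
  have \<rho>: "\<rho> > 0" using pos by (simp add: \<rho>_def)
  fix z assume "z \<in> ball c ((norm (1 - l) + norm l) * r)"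
  then have z: "norm (z - c) / \<rho> < r"
    using pos by (simp add: \<rho>_def dist_norm norm_minus_commute field_simps)
  \<comment> \<open>Multiplying by \<open>cnj (sgn m)\<close> cancels the argument of
    \<open>m\<close>, so for \<open>m = 1 - l\<close> and \<open>m = l\<close> the displacements
    \<open>m * (q m - c)\<close> both point along \<open>z - c\<close> and their lengths add up. For
    \<open>m = 0\<close> the point is \<open>c\<close>, as \<open>sgn 0 = 0\<close>.\<close>
  define q where "q = (\<lambda>m. c + (z - c) / of_real \<rho> * cnj (sgn m))"
  have q: "q m \<in> A" for m
  proof -
    have "norm (q m - c) = norm (z - c) / \<rho> * norm (sgn m)"
      using \<rho> by (simp add: q_def norm_mult norm_divide)
    also have "\<dots> \<le> norm (z - c) / \<rho>"
      using \<rho> by (intro mult_right_le_one_le) (auto simp: norm_sgn)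
    finally have "q m \<in> ball c r"
      using z by (simp add: dist_norm norm_minus_commute)
    then show ?thesis using assms(2) by blast
  qed
  have polar: "m * cnj (sgn m) = of_real (norm m)" for m
  proof (cases "m = 0")
    case False
    then show ?thesis
      by (simp add: sgn_eq complex_norm_square[symmetric] power2_eq_square)
  qed simp
  have "m * q m = m * c + (z - c) / of_real \<rho> * of_real (norm m)" for m
    unfolding q_def polar[symmetric] by (simp add: distrib_left mult_ac)
  then have "(1 - l) * q (1 - l) + l * q l
      = c + (z - c) / of_real \<rho> * (of_real (norm (1 - l)) + of_real (norm l))"
    by (simp add: distrib_left left_diff_distrib)
  also have "\<dots> = c + (z - c) / of_real \<rho> * of_real \<rho>"
    by (simp add: \<rho>_def)
  also have "\<dots> = z" using \<rho> by simp
  finally show "z \<in> A" using A q unfolding lam_convex_def by metis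
qed

lemma lam_convex_interior_nonempty_UNIV:
  assumes A: "lam_convex l A" and "interior A \<noteq> {}" and l: "l \<notin> complex_of_real ` {0..1}"
  shows "A = UNIV"
proof -
  define \<rho> where "\<rho> = norm (1 - l) + norm l"
  have \<rho>: "\<rho> > 1" unfolding \<rho>_def using l by (rule norm_one_minus_add_norm_gt_1)
  obtain c r where r: "r > 0" "ball c r \<subseteq> A"
    using assms(2) by (auto simp: mem_interior)
  have balls: "ball c (\<rho> ^ n * r) \<subseteq> A" for n
  proof (induction n)
    case (Suc n)
    then show ?case
      using lam_convex_ball_expand[OF A, of c "\<rho> ^ n * r"] \<rho> by (simp add: \<rho>_def mult.assoc)
  qed (use r in simp)
  have "z \<in> A" for z
  proof -
    obtain n where "dist c z / r < \<rho> ^ n" using real_arch_pow[OF \<rho>] by blast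
    then have "z \<in> ball c (\<rho> ^ n * r)" using r by (simp add: field_simps)
    then show ?thesis using balls by blast
  qed
  then show ?thesis by blast
qed

text \<open>If all these determinants vanished, every difference of points of \<open>S\<close> would
  be a real multiple of one fixed nonzero difference \<open>b - a\<close>.\<close>

lemma not_collinear_obtain_independent:
  fixes S :: "complex set"
  assumes "\<not> collinear S"
  obtains a b x y where "a \<in> S" "b \<in> S" "x \<in> S" "y \<in> S" "Im (cnj (b - a) * (y - x)) \<noteq> 0"
proof (rule ccontr)
  assume "\<not> thesis"
  with that have zero: "Im (cnj (b - a) * (y - x)) = 0"
    if "a \<in> S" "b \<in> S" "x \<in> S" "y \<in> S" for a b x y using that by blast
  obtain a b where ab: "a \<in> S" "b \<in> S" "a \<noteq> b"
    using assms by (metis collinear_def eq_iff_diff_eq_0 scaleR_zero_left)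
  have "\<exists>c. x - y = c *\<^sub>R (b - a)" if "x \<in> S" "y \<in> S" for x y
  proof -
    have "Im ((x - y) / (b - a)) = 0"
      using zero[OF ab(1,2) that(2,1)] by (simp add: Im_divide algebra_simps)
    then have "(x - y) / (b - a) = of_real (Re ((x - y) / (b - a)))"
      by (simp add: complex_eq_iff)
    then have "x - y = Re ((x - y) / (b - a)) *\<^sub>R (b - a)"
      using ab(3) by (simp add: scaleR_conv_of_real field_simps)
    then show ?thesis by blast
  qed
  then show False using assms unfolding collinear_def by blast
qed

text \<open>Stated for an arbitrary \<open>lam_convex\<close> superset so that it applies to both
  hulls.\<close>

lemma lam_convex_contains_path_UNIV:
  assumes A: "lam_convex l A" and sub: "path_image d \<subseteq> A" and "path d"
    and "\<not> collinear (path_image d)" and l: "l \<notin> complex_of_real ` {0..1}"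
  shows "A = UNIV"
proof -
  have l01: "l \<noteq> 0" "l \<noteq> 1" using l by (auto simp: image_iff)
  obtain a b x y where abxy: "a \<in> path_image d" "b \<in> path_image d" "x \<in> path_image d"
    "y \<in> path_image d" and indep: "Im (cnj (b - a) * (y - x)) \<noteq> 0"
    using not_collinear_obtain_independent[OF assms(4)] by metis
  \<comment> \<open>For real \<open>l\<close> the factors \<open>1 - l\<close> and \<open>l\<close>
    are nonzero reals, so independent chords stay independent. For non-real \<open>l\<close> a
    single chord does for both, because \<open>1 - l\<close> and \<open>l\<close> are themselves
    independent over the reals.\<close>
  obtain x' y' where xy': "x' \<in> path_image d" "y' \<in> path_image d"
    "Im (cnj ((1 - l) * (b - a)) * (l * (y' - x'))) \<noteq> 0"
  proof (cases "Im l = 0")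
    case True
    then have "l = of_real (Re l)" by (simp add: complex_eq_iff)
    then obtain t where t: "l = of_real t" ..
    have "cnj ((1 - l) * (b - a)) * (l * (y - x))
        = of_real ((1 - t) * t) * (cnj (b - a) * (y - x))"
      unfolding t by (simp add: algebra_simps)
    then have "Im (cnj ((1 - l) * (b - a)) * (l * (y - x)))
        = (1 - t) * t * Im (cnj (b - a) * (y - x))"
      by (simp only: times_complex.sel Re_complex_of_real Im_complex_of_real)
    with that[OF abxy(3,4)] indep l01 t show thesis by auto
  next
    case False
    have "cnj ((1 - l) * (b - a)) * (l * (b - a))
        = cnj (1 - l) * l * of_real ((norm (b - a))\<^sup>2)"
      unfolding complex_norm_square by (simp add: algebra_simps)
    then have "Im (cnj ((1 - l) * (b - a)) * (l * (b - a)))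
        = Im (cnj (1 - l) * l) * (norm (b - a))\<^sup>2"
      by (simp only: times_complex.sel Re_complex_of_real Im_complex_of_real)
    also have "Im (cnj (1 - l) * l) = Im l" by (simp add: algebra_simps)
    finally have "Im (cnj ((1 - l) * (b - a)) * (l * (b - a))) \<noteq> 0"
      using False indep by auto
    with that abxy show thesis by blast
  qed
  obtain ta tb tx ty where t: "ta \<in> {0..1}" "tb \<in> {0..1}" "tx \<in> {0..1}" "ty \<in> {0..1}"
    and d: "d ta = a" "d tb = b" "d tx = x'" "d ty = y'"
    using abxy xy' unfolding path_image_def by blast
  \<comment> \<open>Both subpaths run inside the image of \<open>d\<close>, so each sum of a point
    of \<open>g\<close> and a point of \<open>h\<close> is a combination
    \<open>(1 - l) * p + l * q\<close> with \<open>p\<close>, \<open>q\<close> in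
    \<open>A\<close>.\<close>
  define g where "g = (\<lambda>v. (1 - l) * subpath ta tb d v)"
  define h where "h = (\<lambda>v. l * subpath tx ty d v)"
  have "path (subpath ta tb d)" "path (subpath tx ty d)"
    using t assms(3) by auto
  then have "path g" "path h"
    unfolding g_def h_def path_def by (auto intro!: continuous_intros)
  moreover have "pathfinish g - pathstart g = (1 - l) * (b - a)"
    "pathfinish h - pathstart h = l * (y' - x')"
    using d by (simp_all add: g_def h_def pathfinish_def pathstart_def subpath_def algebra_simps)
  ultimately have "interior {p + q |p q. p \<in> path_image g \<and> q \<in> path_image h} \<noteq> {}"
    using xy'(3) by (intro interior_sum_path_images) auto
  moreover have "{p + q |p q. p \<in> path_image g \<and> q \<in> path_image h} \<subseteq> A"
  proof -
    have "path_image (subpath ta tb d) \<subseteq> A" "path_image (subpath tx ty d) \<subseteq> A"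
      using path_image_subpath_subset[OF t(1,2)] path_image_subpath_subset[OF t(3,4)] sub by blast+
    then show ?thesis
      using A by (auto simp: path_image_def g_def h_def lam_convex_def image_subset_iff)
  qed
  ultimately have "interior A \<noteq> {}" using interior_mono by blast
  then show ?thesis using lam_convex_interior_nonempty_UNIV[OF A _ l] by blast
qed

theorem theorem3p9:
  fixes d :: "real \<Rightarrow> complex" and l :: complex
  assumes "path d"
    and "\<not> collinear (path_image d)"
    and "l \<notin> complex_of_real ` {0..1}"
  shows "Q_hull l (path_image d) = UNIV \<and> R_hull l (path_image d) = UNIV"
  using Q_hull_smallest[of l "path_image d"] R_hull_smallest[of l "path_image d"]
    lam_convex_contains_path_UNIV[OF _ _ assms]
  unfolding lam_clonvex_def by blast

end
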